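(* For all integers $p\ge 2$ and $q\ge 3$ with $\gcd(p,q)=1$, we have $$\#\big(D_p\cap K(q,\{0,1,\ldots,q-2,q\})\big)<+\infty.$$
   Context: $\mathbb{N}=\{1,2,3,\ldots\}$; $\#$ denotes cardinality. For an integer $q\ge 2$ and a finite set $A\subset\mathbb{Q}$, $K(q,A)=\big\{\sum_{i=1}^{\infty}\frac{a_i}{q^i}: a_i\in A\ \text{for all } i\in\mathbb{N}\big\}$. The digit set $\{0,1,\ldots,q-2,q\}$ is $(\{0,1,\ldots,q\})\setminus\{q-1\}$. For an integer $p\ge 2$, $D_p=\bigcup_{n=1}^{\infty}\frac{\mathbb{Z}}{p^n}$, where $\frac{\mathbb{Z}}{p^n}=\{m/p^n: m\in\mathbb{Z}\}$ (the rational numbers having a finite $p$-ary expansion). *)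

theory Defs
  imports Complex_Main
begin

(* Digit sequences are indexed from 1, so a 0 is irrelevant and the i-th summand of the
   series is a_(i+1) / q^(i+1).  For finite A and q >= 2 the series always converges. *)
definition K :: "int \<Rightarrow> rat set \<Rightarrow> real set" where
  "K q A = {(\<Sum>i. of_rat (a (Suc i)) / of_int q ^ Suc i) | a :: nat \<Rightarrow> rat. \<forall>i\<ge>1. a i \<in> A}"

(* The rationals with a finite p-ary expansion, as a subset of the reals. *)
definition D :: "int \<Rightarrow> real set" where
  "D p = (\<Union>n\<in>{1::nat..}. {of_int m / of_int p ^ n | m :: int. True})"

end

theory Submission
  imports Defs "HOL-Number_Theory.Residues"
begin

text \<open>
  Write \<open>K\<close> for the self-similar set with digits \<open>0, \<dots>, q - 2, q\<close> and let \<open>E = K + \<int>\<close>.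
  Two observations about \<open>E\<close> pull in opposite directions.

  On the one hand \<open>E\<close> has a gap. Since \<open>q K \<subseteq> K + {0, \<dots>, q - 2, q}\<close>, every element of \<open>q E\<close> is
  \<open>n + y\<close> with \<open>y \<in> K \<subseteq> [0, q / (q - 1)]\<close> and \<open>n\<close> an integer not congruent to \<open>q - 1\<close> modulo \<open>q\<close>.
  A number slightly below \<open>q\<close> could only be obtained with \<open>n = q - 1\<close>, so \<open>E\<close> misses an
  interval \<open>(c, 1)\<close>; for \<open>q \<ge> 3\<close> it has positive length (\<open>K_gap_mod_1\<close>).

  On the other hand \<open>E\<close> is mapped into itself by multiplication by \<open>q\<close>, and the orbit of a
  fraction \<open>x = m / N\<close> in lowest terms with \<open>N\<close> dividing a power of \<open>p\<close> is nearly dense modulo 1.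
  Choose \<open>T\<close> with \<open>q ^ T\<close> congruent to 1 modulo \<open>p\<^sup>2\<close> and put \<open>M = q ^ T - 1\<close>. The powers of \<open>q ^ T\<close>
  reach every residue \<open>1 + M t\<close> modulo every power of \<open>p\<close> (\<open>powers_hit_one_plus_multiples\<close>), and
  because \<open>m\<close> is invertible modulo \<open>N\<close> this means that \<open>E\<close> contains \<open>x + M r / N\<close> for every
  integer \<open>r\<close>. These points have spacing \<open>M / N\<close>, where \<open>M\<close> does not depend on \<open>x\<close>; they avoid
  the gap only if \<open>M / N\<close> is at least its length. Hence \<open>N\<close> is bounded (\<open>K_denominator_bound\<close>),
  and a bounded set contains only finitely many fractions with bounded denominator.
\<close>

section \<open>Powers of an integer congruent to 1\<close>

lemma power_one_plus_second_order:
  fixes a :: int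
  shows "\<exists>w. (1 + a) ^ n = 1 + int n * a + a\<^sup>2 * w"
proof (induction n)
  case 0
  show ?case by (intro exI[of _ 0]) simp
next
  case (Suc n)
  then obtain w where w: "(1 + a) ^ n = 1 + int n * a + a\<^sup>2 * w" by blast
  have "(1 + a) ^ Suc n = 1 + int (Suc n) * a + a\<^sup>2 * (int n + w + a * w)"
    by (simp add: w algebra_simps power2_eq_square)
  then show ?case by blast
qed

text \<open>
  Raising \<open>1 + a\<close> to the power \<open>p\<close> multiplies \<open>a\<close> by \<open>p\<close> up to a factor congruent to 1 modulo \<open>p\<close>:
  the correction \<open>a\<^sup>2 w\<close> equals \<open>p a\<close> times a multiple of \<open>p\<close> as soon as \<open>p\<^sup>2\<close> divides \<open>a\<close>. Asking for
  \<open>p\<^sup>2\<close> instead of \<open>p\<close> is what avoids an exception at the prime 2; this form of lifting the exponent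
  also covers composite \<open>p\<close>.
\<close>
lemma power_of_base_power_exponent:
  fixes Q p :: int
  assumes "p > 0" and "p\<^sup>2 dvd Q - 1"
  shows "\<exists>u. Q ^ (nat p ^ j) = 1 + p ^ j * (Q - 1) * (1 + p * u)"
proof (induction j)
  case 0
  show ?case by (intro exI[of _ 0]) simp
next
  case (Suc j)
  then obtain u where u: "Q ^ (nat p ^ j) = 1 + p ^ j * (Q - 1) * (1 + p * u)" by blast
  define a where "a = p ^ j * (Q - 1) * (1 + p * u)"
  have "p\<^sup>2 dvd a" using assms(2) by (simp add: a_def)
  then obtain b where b: "a = p\<^sup>2 * b" by blast
  obtain w where w: "(1 + a) ^ nat p = 1 + p * a + a\<^sup>2 * w"
    using power_one_plus_second_order[of a "nat p"] assms(1) by auto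
  have "Q ^ (nat p ^ Suc j) = (1 + a) ^ nat p"
    by (simp only: power_Suc2 power_mult u a_def)
  also have "\<dots> = 1 + p * a * (1 + p * (b * w))"
    unfolding w using b by (simp add: algebra_simps power2_eq_square)
  also have "\<dots> = 1 + p ^ Suc j * (Q - 1) * (1 + p * (u + b * w + p * u * b * w))"
    by (simp add: a_def algebra_simps)
  finally show ?case by blast
qed

text \<open>
  A Hensel lifting argument on the exponent. If \<open>Q ^ k\<close> agrees with \<open>1 + M t\<close>, where \<open>M = Q - 1\<close>,
  up to an error \<open>p ^ n M s\<close>, then a further factor \<open>Q ^ (i p ^ n)\<close> changes the error by \<open>i p ^ n M\<close>
  modulo \<open>p ^ (n + 1) M\<close>, and \<open>i\<close> can be chosen congruent to \<open>- s\<close> modulo \<open>p\<close> to cancel it.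
\<close>
lemma powers_hit_one_plus_multiples:
  fixes Q p t :: int
  assumes "p > 0" and "p\<^sup>2 dvd Q - 1"
  shows "\<exists>k. p ^ n * (Q - 1) dvd Q ^ k - 1 - (Q - 1) * t"
proof (induction n)
  case 0
  show ?case by (intro exI[of _ 0]) simp
next
  case (Suc n)
  define M where "M = Q - 1"
  obtain k s where "Q ^ k - 1 - M * t = p ^ n * M * s"
    using Suc unfolding M_def by blast
  then have k: "Q ^ k = 1 + M * t + p ^ n * M * s" by simp
  obtain u where u: "Q ^ (nat p ^ n) = 1 + p ^ n * M * (1 + p * u)"
    using power_of_base_power_exponent[OF assms] unfolding M_def by blast
  define b where "b = p ^ n * M * (1 + p * u)"
  define i where "i = nat ((- s) mod p)"
  obtain v where v: "int i = - s + p * v"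
  proof
    show "int i = - s + p * (- ((- s) div p))"
      using pos_mod_sign[OF assms(1), of "- s"] mult_div_mod_eq[of p "- s"]
      unfolding i_def by (simp only: int_nat_eq if_True mult_minus_right)
  qed
  have "p dvd M" using assms(2) unfolding M_def by (metis dvd_mult_left power2_eq_square)
  then obtain e where e: "M = p * e" by blast
  obtain w where w: "(1 + b) ^ i = 1 + int i * b + b\<^sup>2 * w"
    using power_one_plus_second_order by blast
  have "Q ^ (k + nat p ^ n * i) = Q ^ k * (1 + b) ^ i"
    by (simp add: power_add power_mult u b_def)
  also have "\<dots> = (1 + M * t + p ^ n * M * s) * (1 + int i * b + b\<^sup>2 * w)"
    by (simp only: k w)
  finally have "Q ^ (k + nat p ^ n * i) - 1 - M * t
      = p ^ n * M * s + int i * b + b * (b * w) + M * ((t + p ^ n * s) * b * (int i + b * w))"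
    by (simp add: algebra_simps power2_eq_square)
  moreover have "p ^ Suc n * M dvd p ^ n * M * s + int i * b"
  proof -
    have "p ^ n * M * s + int i * b = p ^ Suc n * M * (v + (- s + p * v) * u)"
      by (simp add: v b_def algebra_simps)
    then show ?thesis by simp
  qed
  moreover have "p ^ Suc n * M dvd b * (b * w)"
  proof -
    have "b * (b * w) = p ^ Suc n * M * ((1 + p * u) * (p ^ n * e * (1 + p * u) * w))"
      unfolding b_def by (simp add: e)
    then show ?thesis by (metis dvd_triv_left)
  qed
  moreover have "p ^ Suc n * M dvd M * ((t + p ^ n * s) * b * (int i + b * w))"
  proof -
    have "M * ((t + p ^ n * s) * b * (int i + b * w))
        = p ^ Suc n * M * (e * (t + p ^ n * s) * (1 + p * u) * (int i + b * w))"
      by (subst b_def) (simp add: e algebra_simps)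
    then show ?thesis by (metis dvd_triv_left)
  qed
  ultimately have "p ^ Suc n * M dvd Q ^ (k + nat p ^ n * i) - 1 - M * t"
    by (metis dvd_add)
  then show ?case unfolding M_def by blast
qed

section \<open>Self-similarity and a gap modulo 1\<close>

lemma K_int_digits:
  assumes "x \<in> K q (rat_of_int ` S)"
  obtains d where "\<And>i. d i \<in> S" and "x = (\<Sum>i. real_of_int (d i) / of_int q ^ Suc i)"
proof -
  obtain a where a: "\<forall>i\<ge>1. a i \<in> rat_of_int ` S"
    and x: "x = (\<Sum>i. of_rat (a (Suc i)) / of_int q ^ Suc i)"
    using assms unfolding K_def by blast
  have "\<forall>i. \<exists>d. d \<in> S \<and> a (Suc i) = rat_of_int d" using a by auto
  then obtain d where "\<And>i. d i \<in> S" "\<And>i. a (Suc i) = rat_of_int (d i)" by metis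
  then show thesis using that[of d] x by simp
qed

lemma K_int_digitsI:
  assumes "\<And>i. d i \<in> S"
  shows "(\<Sum>i. real_of_int (d i) / of_int q ^ Suc i) \<in> K q (rat_of_int ` S)"
  unfolding K_def using assms
  by (intro CollectI exI[of _ "\<lambda>i. rat_of_int (d (i - 1))"]) auto

lemma digit_series_bounds:
  fixes q :: int and d :: "nat \<Rightarrow> int"
  assumes "q \<ge> 2" and "\<And>i. d i \<in> {0..q}"
  shows "summable (\<lambda>i. real_of_int (d i) / of_int q ^ Suc i)"
    and "(\<Sum>i. real_of_int (d i) / of_int q ^ Suc i) \<in> {0..of_int q / (of_int q - 1)}"
proof -
  have "(\<lambda>i. (1 / real_of_int q) ^ i) sums (1 / (1 - 1 / real_of_int q))"
    using assms(1) by (intro geometric_sums) auto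
  then have geo: "(\<lambda>i. (1 / real_of_int q) ^ i) sums (of_int q / (of_int q - 1))"
    using assms(1) by (simp add: field_simps)
  have le: "real_of_int (d i) / of_int q ^ Suc i \<le> (1 / of_int q) ^ i" for i
    using assms(2)[of i] assms(1) by (simp add: field_simps)
  have nonneg: "0 \<le> real_of_int (d i) / of_int q ^ Suc i" for i
    using assms(2)[of i] assms(1) by auto
  show summ: "summable (\<lambda>i. real_of_int (d i) / of_int q ^ Suc i)"
    using le nonneg
    by (intro summable_comparison_test'[OF sums_summable[OF geo], of 0])
       (simp only: real_norm_def abs_of_nonneg)
  have "(\<Sum>i. real_of_int (d i) / of_int q ^ Suc i) \<le> of_int q / (of_int q - 1)"
    using suminf_le[OF le summ sums_summable[OF geo]] sums_unique[OF geo] by simp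
  then show "(\<Sum>i. real_of_int (d i) / of_int q ^ Suc i) \<in> {0..of_int q / (of_int q - 1)}"
    using suminf_nonneg[OF summ nonneg] by simp
qed

lemma K_bounds:
  assumes "q \<ge> 2" and "S \<subseteq> {0..q}" and "x \<in> K q (rat_of_int ` S)"
  shows "x \<in> {0..of_int q / (of_int q - 1)}"
  using assms(3)
proof (rule K_int_digits)
  fix d assume "\<And>i. d i \<in> S" and "x = (\<Sum>i. real_of_int (d i) / of_int q ^ Suc i)"
  then show ?thesis using digit_series_bounds(2)[of q d] assms(1,2) by blast
qed

lemma K_shift:
  assumes "q \<ge> 2" and "S \<subseteq> {0..q}" and "x \<in> K q (rat_of_int ` S)"
  obtains a y where "a \<in> S" and "y \<in> K q (rat_of_int ` S)"
    and "of_int q * x = of_int a + y"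
proof -
  obtain d where d: "\<And>i. d i \<in> S" and x: "x = (\<Sum>i. real_of_int (d i) / of_int q ^ Suc i)"
    using K_int_digits[OF assms(3)] by metis
  define y where "y = (\<Sum>i. real_of_int (d (Suc i)) / of_int q ^ Suc i)"
  have "summable (\<lambda>i. real_of_int (d i) / of_int q ^ Suc i)"
    using digit_series_bounds(1) d assms(1,2) by blast
  then have "x = of_int (d 0) / of_int q + (\<Sum>i. real_of_int (d (Suc i)) / of_int q ^ Suc (Suc i))"
    unfolding x by (subst suminf_split_head) auto
  also have "(\<Sum>i. real_of_int (d (Suc i)) / of_int q ^ Suc (Suc i))
      = (\<Sum>i. real_of_int (d (Suc i)) / of_int q ^ Suc i / of_int q)"
    by (simp add: mult.commute)
  also have "\<dots> = y / of_int q"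
    unfolding y_def
    by (intro suminf_divide digit_series_bounds(1)) (use d assms(1,2) in blast)+
  finally have "of_int q * x = of_int (d 0) + y" using assms(1) by (simp add: field_simps)
  moreover have "y \<in> K q (rat_of_int ` S)"
    unfolding y_def using d by (intro K_int_digitsI)
  ultimately show thesis using that d by blast
qed

text \<open>Multiplication by \<open>q\<close> maps \<open>K + \<int>\<close> into itself because all digits are integers.\<close>
lemma K_orbit:
  assumes "q \<ge> 2" and "S \<subseteq> {0..q}" and "x \<in> K q (rat_of_int ` S)"
  shows "\<exists>z. of_int q ^ k * x + of_int z \<in> K q (rat_of_int ` S)"
proof (induction k)
  case 0
  show ?case using assms(3) by (intro exI[of _ 0]) simp
next
  case (Suc k)
  then obtain z where "of_int q ^ k * x + of_int z \<in> K q (rat_of_int ` S)" by blast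
  then obtain a y where y: "y \<in> K q (rat_of_int ` S)"
    and "of_int q * (of_int q ^ k * x + of_int z) = of_int a + y"
    using K_shift[OF assms(1,2)] by metis
  then have "of_int q ^ Suc k * x + of_int (q * z - a) = y" by (simp add: algebra_simps)
  then show ?case using y by metis
qed

text \<open>
  After multiplication by \<open>q\<close>, a point of the interval would be \<open>n + y\<close> with
  \<open>0 \<le> y \<le> q / (q - 1) = 1 + 1 / (q - 1)\<close> and \<open>n\<close> congruent to the first digit modulo \<open>q\<close>. The interval
  is the largest one ending at 1 for which these bounds force \<open>q - 2 < n < q\<close>, that is, \<open>n = q - 1\<close>,
  and \<open>q - 1\<close> is the one residue class not represented by a digit.
\<close>
lemma K_gap_mod_1:
  fixes q z :: int
  assumes "q \<ge> 3" and "x \<in> K q (rat_of_int ` ({0..q} - {q - 1}))"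
  shows "x + of_int z \<notin> {1 - (of_int q - 2) / (of_int q * (of_int q - 1))<..<1}"
proof
  assume "x + of_int z \<in> {1 - (of_int q - 2) / (of_int q * (of_int q - 1))<..<1}"
  then have lo: "1 - (of_int q - 2) / (of_int q * (of_int q - 1)) < x + of_int z"
    and hi: "x + of_int z < 1" by auto
  obtain a y where a: "a \<in> {0..q} - {q - 1}" and yK: "y \<in> K q (rat_of_int ` ({0..q} - {q - 1}))"
    and qx: "of_int q * x = of_int a + y"
    using K_shift[of q "{0..q} - {q - 1}" x] assms by auto
  have y: "0 \<le> y" "y \<le> of_int q / (of_int q - 1)"
    using K_bounds[of q _ y, OF _ _ yK] assms(1) by auto
  have qxz: "of_int q * (x + of_int z) = of_int (a + q * z) + y"
    using qx by (simp add: algebra_simps)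
  have "of_int q * (x + of_int z) < of_int q * 1"
    using hi assms(1) by (intro mult_strict_left_mono) auto
  then have "real_of_int (a + q * z) < of_int q" using qxz y(1) by linarith
  then have upper: "a + q * z < q" by linarith
  have "of_int q * (1 - (of_int q - 2) / (of_int q * (of_int q - 1))) < of_int q * (x + of_int z)"
    using lo assms(1) by (intro mult_strict_left_mono) auto
  moreover have "of_int q * (1 - (of_int q - 2) / (of_int q * (of_int q - 1)))
      = of_int q - 2 + of_int q / (real_of_int q - 1)"
    using assms(1) by (simp add: divide_simps) (simp add: algebra_simps)
  ultimately have "real_of_int (q - 2) < of_int (a + q * z)" using qxz y(2) by simp
  then have "q - 2 < a + q * z" by linarith
  with upper have eq: "a + q * z = q - 1" by linarith
  \<comment> \<open>Here \<open>a\<close> lies in \<open>{0..q}\<close> and is congruent to \<open>q - 1\<close>, so it equals the forbidden digit.\<close>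
  then have "a = q * (1 - z) - 1" by (simp add: algebra_simps)
  moreover have "0 \<le> a" "a \<le> q" using a by auto
  ultimately have "0 < q * (1 - z)" "q * (1 - z) < q * 2" using assms(1) by linarith+
  then have "0 < 1 - z" "1 - z < 2"
    using assms(1) by (simp_all only: zero_less_mult_iff mult_less_cancel_left) linarith+
  then have "z = 0" by linarith
  then show False using eq a by auto
qed

section \<open>Bounding the denominators\<close>

text \<open>
  If the bound failed, the progression \<open>x + M r / N\<close> would have a spacing smaller than the gap of
  \<open>K + \<int>\<close> and so would enter it for some \<open>r\<close>. That very point lies, modulo 1, on the orbit of \<open>x\<close>:
  solve \<open>m t = r\<close> modulo \<open>N\<close> and take an exponent with \<open>q ^ (T k)\<close> congruent to \<open>1 + M t\<close>. Solving
  for \<open>t\<close> first keeps the argument free of the common factors of \<open>M\<close> and \<open>N\<close>.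
\<close>
lemma K_denominator_bound:
  fixes p q m N :: int
  assumes "p \<ge> 2" and "q \<ge> 3" and "T > 0" and "p\<^sup>2 dvd q ^ T - 1"
    and "N > 0" and "coprime m N" and "N dvd p ^ n"
    and xK: "of_int m / of_int N \<in> K q (rat_of_int ` ({0..q} - {q - 1}))"
  shows "N * (q - 2) \<le> (q ^ T - 1) * (q * (q - 1))"
proof (rule ccontr)
  assume big: "\<not> N * (q - 2) \<le> (q ^ T - 1) * (q * (q - 1))"
  define M where "M = q ^ T - 1"
  define x where "x = real_of_int m / of_int N"
  define c where "c = 1 - (real_of_int q - 2) / (of_int q * (of_int q - 1))"
  have "1 < q ^ T" using assms(2,3) by (intro one_less_power) auto
  then have "M > 0" by (simp add: M_def)
  have "real_of_int (M * (q * (q - 1))) < of_int (N * (q - 2))"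
    using big unfolding M_def by linarith
  then have step: "of_int M / of_int N < 1 - c"
    using assms(2,5) by (simp add: c_def field_simps)
  \<comment> \<open>The first term of the progression beyond \<open>c\<close>; its spacing keeps it below 1.\<close>
  define r where "r = \<lfloor>(c - x) / (of_int M / of_int N)\<rfloor> + 1"
  have "(c - x) / (of_int M / of_int N) < of_int r"
       "of_int r \<le> (c - x) / (of_int M / of_int N) + 1" unfolding r_def by linarith+
  then have "c - x < of_int r * (of_int M / of_int N)"
       "of_int r * (of_int M / of_int N) \<le> c - x + of_int M / of_int N"
    using \<open>M > 0\<close> assms(5) by (auto simp: field_simps)
  then have in_gap: "x + of_int r * (of_int M / of_int N) \<in> {c<..<1}"
    using step by auto
  obtain m' where "[m * m' = 1] (mod N)"
    using assms(6) cong_solve_coprime_int by blast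
  then have "[m * (m' * r) = r] (mod N)"
    using cong_scalar_right[of "m * m'" 1 N r] by (simp add: mult.assoc)
  then have t: "[M * (m * (m' * r)) = M * r] (mod N)" by (rule cong_scalar_left)
  obtain k where "p ^ n * M dvd (q ^ T) ^ k - 1 - M * (m' * r)"
    using powers_hit_one_plus_multiples[of p "q ^ T"] assms(1,4) unfolding M_def by force
  then have "N dvd (q ^ T) ^ k - 1 - M * (m' * r)"
    using assms(7) by (meson dvd_mult_left dvd_trans)
  then have "[q ^ (T * k) = 1 + M * (m' * r)] (mod N)"
    by (simp add: cong_iff_dvd_diff power_mult algebra_simps)
  then have "[q ^ (T * k) * m = (1 + M * (m' * r)) * m] (mod N)" by (rule cong_scalar_right)
  moreover have "[(1 + M * (m' * r)) * m = m + M * r] (mod N)"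
    using cong_add[OF cong_refl[of m] t] by (simp add: algebra_simps)
  ultimately have "[q ^ (T * k) * m = m + M * r] (mod N)" by (rule cong_trans)
  then obtain h where "q ^ (T * k) * m = m + M * r + N * h"
    by (metis cong_iff_lin cong_sym)
  then have "real_of_int (q ^ (T * k) * m) = of_int (m + M * r + N * h)" by simp
  then have orbit: "of_int q ^ (T * k) * x = x + of_int r * (of_int M / of_int N) + of_int h"
    using assms(5) unfolding x_def by (simp add: field_simps)
  obtain z where z: "of_int q ^ (T * k) * x + of_int z \<in> K q (rat_of_int ` ({0..q} - {q - 1}))"
    using K_orbit[of q "{0..q} - {q - 1}" x] xK assms(2) unfolding x_def by auto
  have "of_int q ^ (T * k) * x + of_int z + of_int (- h - z) = x + of_int r * (of_int M / of_int N)"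
    using orbit by simp
  then show False
    using K_gap_mod_1[OF assms(2) z, of "- h - z"] in_gap unfolding c_def by simp
qed

lemma D_lowest_terms:
  assumes "p \<ge> 2" and "x \<in> D p"
  obtains m N n where "N > 0" and "coprime m N" and "N dvd p ^ n" and "x = of_int m / of_int N"
proof -
  obtain m n where x: "x = of_int m / of_int p ^ n" using assms(2) unfolding D_def by blast
  define g where "g = gcd m (p ^ n)"
  have pn: "p ^ n > 0" using assms(1) by simp
  then have g: "g > 0" unfolding g_def by (metis gcd_pos_int less_irrefl)
  have dvd: "g dvd m" "g dvd p ^ n" unfolding g_def by auto
  show thesis
  proof
    show "p ^ n div g > 0" using g pn dvd(2) by (simp add: pos_imp_zdiv_pos_iff zdvd_imp_le)
    show "coprime (m div g) (p ^ n div g)"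
      unfolding g_def using pn by (intro div_gcd_coprime) linarith
    show "p ^ n div g dvd p ^ n" using dvd(2) by (metis dvd_div_mult_self dvd_triv_left)
    have "real_of_int m / of_int (p ^ n) = of_int (m div g) / of_int (p ^ n div g)"
      using g dvd by (simp add: real_of_int_div)
    then show "x = of_int (m div g) / of_int (p ^ n div g)" using x by simp
  qed
qed

theorem corollary1p3:
  fixes p q :: int
  assumes "p \<ge> 2" and "q \<ge> 3" and "gcd p q = 1"
  shows "finite (D p \<inter> K q (rat_of_int ` ({0..q} - {q - 1})))"
proof -
  define T where "T = totient (nat (p\<^sup>2))"
  have p2: "p\<^sup>2 > 0" using assms(1) by simp
  have "T > 0" unfolding T_def using p2 by (simp add: totient_gt_0_iff)
  have "coprime q (p\<^sup>2)" using assms(3) by (simp add: coprime_iff_gcd_eq_1[symmetric] coprime_commute)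
  moreover have "residues (p\<^sup>2)" using assms(1) by (simp add: residues_def one_less_power)
  ultimately have "[q ^ T = 1] (mod p\<^sup>2)" unfolding T_def by (simp only: residues.euler_theorem)
  then have T: "p\<^sup>2 dvd q ^ T - 1" by (simp add: cong_iff_dvd_diff)
  \<comment> \<open>Points of \<open>K\<close> are at most \<open>q / (q - 1) \<le> 2\<close>, so \<open>2 B\<close> also bounds the numerators.\<close>
  define B where "B = (q ^ T - 1) * (q * (q - 1))"
  have "D p \<inter> K q (rat_of_int ` ({0..q} - {q - 1}))
      \<subseteq> (\<lambda>(m, N). real_of_int m / of_int N) ` ({0..2 * B} \<times> {1..B})"
  proof
    fix x assume x: "x \<in> D p \<inter> K q (rat_of_int ` ({0..q} - {q - 1}))"
    obtain m N n where N: "N > 0" "coprime m N" "N dvd p ^ n" and mN: "x = of_int m / of_int N"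
      using D_lowest_terms[OF assms(1), of x] x by blast
    have "N * (q - 2) \<le> B"
      unfolding B_def using K_denominator_bound[OF assms(1,2) \<open>T > 0\<close> T N] x mN by simp
    moreover have "N * 1 \<le> N * (q - 2)" using N(1) assms(2) by (intro mult_left_mono) auto
    ultimately have "N \<le> B" by simp
    have "0 \<le> x" "x \<le> of_int q / (of_int q - 1)"
      using K_bounds[of q "{0..q} - {q - 1}" x] x assms(2) by auto
    moreover have "of_int q / (real_of_int q - 1) \<le> 2" using assms(2) by (simp add: field_simps)
    ultimately have "0 \<le> x" "x \<le> 2" by auto
    then have "0 \<le> real_of_int m" "real_of_int m \<le> of_int (2 * N)"
      using N(1) unfolding mN by (auto simp: field_simps zero_le_divide_iff)
    then have "0 \<le> m" "m \<le> 2 * N" by linarith+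
    then show "x \<in> (\<lambda>(m, N). real_of_int m / of_int N) ` ({0..2 * B} \<times> {1..B})"
      using mN N(1) \<open>N \<le> B\<close> by (intro image_eqI[of _ _ "(m, N)"]) auto
  qed
  then show ?thesis by (rule finite_subset) auto
qed

end
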